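(* Let $h$ be a dimension function, let $N\in\mathbb{N}$, and let $\tilde{\mathcal{P}}$ be the family of non-constant polynomials in several variables $\tilde P:\mathbb{R}^N\to\mathbb{R}$ (with real coefficients). Then there exists a perfect set $E\subseteq\mathbb{R}$ such that $\mathcal{H}^h(E)=0$ and $\bigcap_{1\le i\le n}\tilde P_i^{-1}(E)\neq\emptyset$ for any finite subset $\{\tilde P_1,\dots,\tilde P_n\}$ of $\tilde{\mathcal{P}}$.
   Context: A dimension function is a function $h:\mathbb{R}_{\ge0}\to\mathbb{R}\cup\{+\infty\}$ that is non-decreasing and right continuous, with $h(0)=0$ and $h(t)>0$ for $t>0$. The associated (outer) Hausdorff measure is $\mathcal{H}^h(E)=\lim_{\delta\to0}\inf\{\sum_i h(|U_i|):\{U_i\}_i\text{ a (countable) }\delta\text{-covering of }E\}$, where $|U|$ is the diameter of $U$ and a $\delta$-covering is a covering by sets of diameter at most $\delta$. A perfect set is a closed set without isolated points. *)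

theory Defs
  imports "HOL-Analysis.Analysis"
begin

(* A non-decreasing h with h 0 = 0 takes no negative value on {0..}, so the codomain
   "reals with +infinity" is rendered by ennreal.  Values of h at negative arguments
   are irrelevant. *)
definition dimension_function :: "(real \<Rightarrow> ennreal) \<Rightarrow> bool" where
  "dimension_function h \<longleftrightarrow>
     mono_on {0..} h \<and>
     (\<forall>t\<ge>0. continuous (at_right t) h) \<and>
     h 0 = 0 \<and>
     (\<forall>t>0. h t > 0)"

(* Boundedness is explicit because the real-valued diameter carries no information
   on unbounded sets.  Finite coverings are included: pad with empty sets, which
   contribute h 0 = 0 to the sum below. *)
definition delta_covering :: "real \<Rightarrow> 'a::metric_space set \<Rightarrow> (nat \<Rightarrow> 'a set) \<Rightarrow> bool" where
  "delta_covering \<delta> E U \<longleftrightarrow>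
     E \<subseteq> (\<Union>i. U i) \<and> (\<forall>i. bounded (U i) \<and> diameter (U i) \<le> \<delta>)"

definition hausdorff_premeasure ::
    "(real \<Rightarrow> ennreal) \<Rightarrow> real \<Rightarrow> 'a::metric_space set \<Rightarrow> ennreal" where
  "hausdorff_premeasure h \<delta> E =
     (INF U \<in> {U. delta_covering \<delta> E U}. \<Sum>i. h (diameter (U i)))"

definition hausdorff_measure :: "(real \<Rightarrow> ennreal) \<Rightarrow> 'a::metric_space set \<Rightarrow> ennreal" where
  "hausdorff_measure h E = Lim (at_right 0) (\<lambda>\<delta>. hausdorff_premeasure h \<delta> E)"

lemma hausdorff_premeasure_antimono:
  assumes "\<delta> \<le> \<epsilon>"
  shows "hausdorff_premeasure h \<epsilon> E \<le> hausdorff_premeasure h \<delta> E"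
  unfolding hausdorff_premeasure_def
proof (rule INF_superset_mono)
  show "{U. delta_covering \<delta> E U} \<subseteq> {U. delta_covering \<epsilon> E U}"
    unfolding delta_covering_def using order_trans[OF _ assms] by blast
qed simp

(* The limit in the definition always exists. *)
lemma hausdorff_premeasure_tendsto:
  "((\<lambda>\<delta>. hausdorff_premeasure h \<delta> E) \<longlongrightarrow> hausdorff_measure h E) (at_right 0)"
proof -
  let ?f = "\<lambda>\<delta>. hausdorff_premeasure h \<delta> E"
  let ?S = "SUP \<delta>\<in>{0<..}. ?f \<delta>"
  have "(?f \<longlongrightarrow> ?S) (at_right 0)"
  proof (rule order_tendstoI)
    fix a assume "a < ?S"
    then obtain \<epsilon> where \<epsilon>: "\<epsilon> > 0" "a < ?f \<epsilon>"
      by (auto simp: less_SUP_iff)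
    show "eventually (\<lambda>\<delta>. a < ?f \<delta>) (at_right 0)"
      unfolding eventually_at_right_field
      using \<epsilon> hausdorff_premeasure_antimono
      by (meson less_imp_le order_less_le_trans)
  next
    fix a assume a: "?S < a"
    show "eventually (\<lambda>\<delta>. ?f \<delta> < a) (at_right 0)"
      unfolding eventually_at_right_field
    proof (intro exI[of _ 1] conjI allI impI)
      fix \<delta> :: real assume "0 < \<delta>"
      then have "?f \<delta> \<le> ?S" by (intro SUP_upper) auto
      with a show "?f \<delta> < a" by simp
    qed simp
  qed
  moreover from this have "hausdorff_measure h E = ?S"
    unfolding hausdorff_measure_def by (intro tendsto_Lim) auto
  ultimately show ?thesis by simp
qed

definition perfect_set :: "'a::topological_space set \<Rightarrow> bool" where
  "perfect_set E \<longleftrightarrow> closed E \<and> \<not> (\<exists>x. x isolated_in E)"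

definition nonconstant_polynomials :: "(real ^ 'n \<Rightarrow> real) set" where
  "nonconstant_polynomials = {P. real_polynomial_function P \<and> \<not> P constant_on UNIV}"

end

theory Submission
  imports Defs "HOL-Computational_Algebra.Polynomial" "HOL-Real_Asymp.Real_Asymp"
begin

text \<open>
  Fix scales with \<open>s (k+1)\<close> much smaller than \<open>r k\<close>, and \<open>r k\<close> so small compared to \<open>s k\<close> that the
  \<open>r k\<close>-neighbourhoods of the lattice \<open>s k \<int>\<close> cover bounded sets at small \<open>h\<close>-cost. Split the stages \<open>k\<close>
  into infinitely many infinite classes. Let \<open>A\<^sub>j\<close> be the set of \<open>x\<close> with \<open>x\<^sup>2 \<ge> j\<close> that are \<open>r k\<close>-close to
  \<open>s k \<int>\<close> at every stage \<open>k\<close> of class \<open>j\<close>. The union of the \<open>A\<^sub>j\<close> is null, and closed because it is locally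
  finite. Finitely many polynomials on \<open>\<real>\<^sup>N\<close> restrict to nonconstant polynomials on a common line. There
  they are placed in different classes, so that each stage constrains only one of them and nested
  intervals produce a common parameter. Far out on the line the values of the polynomials are
  large enough for the constraint \<open>x\<^sup>2 \<ge> j\<close>, while the distortion of intervals, which is polynomial in
  the parameter, is absorbed by the exponential decay of \<open>s (k+1) / r k\<close>. The nested intervals can avoid
  a prescribed countable set, so the closed set may be replaced by its set of condensation points,
  which is perfect.
\<close>

section \<open>Null sets of the Hausdorff measure\<close>

text \<open>Stated through explicit coverings, so that subsets and countable unions can be handled
  without taking limits or infima.\<close>

definition hausdorff_null :: "(real \<Rightarrow> ennreal) \<Rightarrow> 'a::metric_space set \<Rightarrow> bool" where
  "hausdorff_null h E \<longleftrightarrow>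
     (\<forall>\<delta>>0. \<forall>\<epsilon>>0. \<exists>U. delta_covering \<delta> E U \<and> (\<Sum>i. h (diameter (U i))) \<le> ennreal \<epsilon>)"

lemma hausdorff_null_imp_measure_0:
  assumes "hausdorff_null h E"
  shows "hausdorff_measure h E = 0"
proof -
  have "hausdorff_premeasure h \<delta> E = 0" if "\<delta> > 0" for \<delta>
  proof -
    have *: "hausdorff_premeasure h \<delta> E \<le> 0 + ennreal \<epsilon>" if "\<epsilon> > 0" for \<epsilon>
    proof -
      obtain U where "delta_covering \<delta> E U" "(\<Sum>i. h (diameter (U i))) \<le> ennreal \<epsilon>"
        using assms \<open>\<delta> > 0\<close> \<open>\<epsilon> > 0\<close> unfolding hausdorff_null_def by blast
      then show ?thesis
        unfolding hausdorff_premeasure_def by (auto intro: INF_lower2)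
    qed
    have "hausdorff_premeasure h \<delta> E \<le> 0"
      by (rule ennreal_le_epsilon) (rule *)
    then show ?thesis by simp
  qed
  then have "eventually (\<lambda>\<delta>. hausdorff_premeasure h \<delta> E = 0) (at_right 0)"
    by (intro eventually_at_rightI[of 0 1]) auto
  then have "((\<lambda>\<delta>. hausdorff_premeasure h \<delta> E) \<longlongrightarrow> 0) (at_right 0)"
    by (rule tendsto_eventually)
  then show ?thesis
    using hausdorff_premeasure_tendsto tendsto_unique trivial_limit_at_right_real by blast
qed

lemma hausdorff_null_subset:
  "hausdorff_null h E \<Longrightarrow> F \<subseteq> E \<Longrightarrow> hausdorff_null h F"
  unfolding hausdorff_null_def delta_covering_def by (meson order_trans)

lemma hausdorff_null_UN:
  fixes E :: "nat \<Rightarrow> 'a::metric_space set"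
  assumes "\<And>j. hausdorff_null h (E j)"
  shows "hausdorff_null h (\<Union>j. E j)"
  unfolding hausdorff_null_def
proof (intro allI impI)
  fix \<delta> \<epsilon> :: real assume "\<delta> > 0" "\<epsilon> > 0"
  have "\<exists>U. delta_covering \<delta> (E j) U \<and> (\<Sum>i. h (diameter (U i))) \<le> ennreal (\<epsilon> * (1/2)^Suc j)" for j
    using assms[of j] \<open>\<delta> > 0\<close> \<open>\<epsilon> > 0\<close> unfolding hausdorff_null_def by simp
  then obtain U where U: "\<And>j. delta_covering \<delta> (E j) (U j)"
      "\<And>j. (\<Sum>i. h (diameter (U j i))) \<le> ennreal (\<epsilon> * (1/2)^Suc j)"
    by metis
  define V where "V = (\<lambda>i. case_prod U (prod_decode i))"
  have cov: "delta_covering \<delta> (\<Union>j. E j) V"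
  proof -
    have "x \<in> (\<Union>i. V i)" if x: "x \<in> E j" for x j
    proof -
      obtain i where "x \<in> U j i"
        using U(1)[of j] x unfolding delta_covering_def by auto
      then have "x \<in> V (prod_encode (j, i))"
        by (simp add: V_def)
      then show ?thesis by (rule UN_I[OF UNIV_I])
    qed
    then have "(\<Union>j. E j) \<subseteq> (\<Union>i. V i)" by blast
    moreover have "bounded (V i) \<and> diameter (V i) \<le> \<delta>" for i
      using U(1)[of "fst (prod_decode i)"]
      unfolding delta_covering_def V_def by (simp add: case_prod_beta)
    ultimately show ?thesis unfolding delta_covering_def by blast
  qed
  have "(\<Sum>i. h (diameter (V i))) = (\<Sum>j. \<Sum>i. h (diameter (U j i)))"
    unfolding V_def
    by (subst suminf_ennreal_2dimen[symmetric, where f = "\<lambda>x. h (diameter (case_prod U x))"]) auto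
  also have "\<dots> \<le> (\<Sum>j. ennreal (\<epsilon> * (1/2)^Suc j))"
    using U(2) by (intro suminf_le) auto
  also have "\<dots> = ennreal \<epsilon>"
  proof -
    have "(\<lambda>j. \<epsilon> * (1/2)^Suc j) sums (\<epsilon> * 1)"
      by (intro sums_mult power_half_series)
    then show ?thesis
      using \<open>\<epsilon> > 0\<close> by (intro suminf_ennreal_eq) auto
  qed
  finally show "\<exists>U. delta_covering \<delta> (\<Union>j. E j) U \<and> (\<Sum>i. h (diameter (U i))) \<le> ennreal \<epsilon>"
    using cov by blast
qed

text \<open>A single stage \<open>k\<close> suffices for each pair \<delta>, \<epsilon>. On [-M, M]
  the set is covered by about 2M / \<open>s k\<close> intervals of length \<open>2 * r k\<close>,
  each costing at most \<open>s k / (k + 1)\<close>. The total is O(M / (k + 1)), and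
  \<open>inf\<close> provides arbitrarily late stages.\<close>

lemma hausdorff_null_lattice_neighbourhoods:
  fixes s r :: "nat \<Rightarrow> real"
  assumes h0: "h 0 = 0"
    and r: "\<And>k. 0 < r k" "\<And>k. r k \<le> s k"
    and s: "\<And>k. s k \<le> exp (- real k)"
    and hr: "\<And>k. h (2 * r k) \<le> ennreal (s k / (real k + 1))"
    and inf: "\<And>m. \<exists>k\<ge>m. C k"
  shows "hausdorff_null h {x. \<forall>k. C k \<longrightarrow> (\<exists>z::int. \<bar>x - s k * z\<bar> \<le> r k)}"
proof -
  define A where "A = {x. \<forall>k. C k \<longrightarrow> (\<exists>z::int. \<bar>x - s k * z\<bar> \<le> r k)}"
  have "hausdorff_null h (A \<inter> {- real M..real M})" for M
    unfolding hausdorff_null_def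
  proof (intro allI impI)
    fix \<delta> \<epsilon> :: real assume \<delta>: "\<delta> > 0" and \<epsilon>: "\<epsilon> > 0"
    have "eventually (\<lambda>k. 2 * exp (- real k) < \<delta>) sequentially"
      using \<delta> by real_asymp
    moreover have "eventually (\<lambda>k. (2 * real M + 5) / (real k + 1) < \<epsilon>) sequentially"
      using \<epsilon> by real_asymp
    ultimately have "eventually (\<lambda>k. 2 * exp (- real k) < \<delta> \<and> (2 * real M + 5) / (real k + 1) < \<epsilon>) sequentially"
      by (rule eventually_conj)
    then obtain k where k: "C k" "2 * exp (- real k) < \<delta>" "(2 * real M + 5) / (real k + 1) < \<epsilon>"
      using inf unfolding eventually_sequentially by metis
    have spos: "s k > 0" using r[of k] by linarith
    have s1: "s k \<le> 1" using s[of k] by (rule order_trans) simp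
    \<comment> \<open>A lattice point within \<open>r k\<close> of [-M, M] has index at most M /
      \<open>s k\<close> + 1 in absolute value, as \<open>r k \<le> s k\<close>. Index
      \<open>i\<close> stands for z = i - q. Since q is at most M / \<open>s k\<close> + 2, the 2q +
      1 intervals satisfy (2q + 1) \<open>s k\<close> \<le> 2M + 5 \<open>s k\<close>, whence the 5
      in the choice of \<open>k\<close>.\<close>
    define q where "q = nat \<lceil>real M / s k\<rceil> + 1"
    have q: "real M / s k + 1 \<le> real q" "real q \<le> real M / s k + 2"
      unfolding q_def using spos by (auto simp: real_nat_ceiling_ge) linarith+
    define U where "U = (\<lambda>i. if i < 2 * q + 1
        then {s k * (real i - real q) - r k .. s k * (real i - real q) + r k} else {})"
    have "A \<inter> {- real M..real M} \<subseteq> (\<Union>i. U i)"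
    proof
      fix x assume x: "x \<in> A \<inter> {- real M..real M}"
      then obtain z :: int where z: "\<bar>x - s k * z\<bar> \<le> r k"
        using k(1) unfolding A_def by blast
      have "s k * \<bar>real_of_int z\<bar> = \<bar>s k * z\<bar>"
        using spos by (simp add: abs_mult)
      also have "\<dots> \<le> real M + s k"
        using z x r(2)[of k] by auto
      also have "\<dots> = s k * (real M / s k + 1)"
        using spos by (simp add: field_simps)
      also have "\<dots> \<le> s k * real q"
        using q(1) spos by simp
      finally have zq: "\<bar>z\<bar> \<le> int q" using spos by simp
      define i where "i = nat (z + int q)"
      have "real i = z + real q" "i < 2 * q + 1"
        using zq unfolding i_def by auto
      then have "x \<in> U i"
        using z unfolding U_def by (auto simp: abs_le_iff)
      then show "x \<in> (\<Union>i. U i)" by blast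
    qed
    moreover have "bounded (U i) \<and> diameter (U i) \<le> \<delta>" for i
      using r[of k] s[of k] k(2) \<delta> unfolding U_def by auto
    ultimately have "delta_covering \<delta> (A \<inter> {- real M..real M}) U"
      unfolding delta_covering_def by blast
    moreover have "(\<Sum>i. h (diameter (U i))) \<le> ennreal \<epsilon>"
    proof -
      have "(\<Sum>i. h (diameter (U i))) = (\<Sum>i<2*q+1. h (diameter (U i)))"
        by (rule suminf_finite) (auto simp: U_def h0)
      also have "\<dots> = (\<Sum>i<2*q+1. h (2 * r k))"
        using r(1)[of k] by (intro sum.cong) (auto simp: U_def)
      also have "\<dots> = ennreal (real (2*q+1)) * h (2 * r k)"
        by (simp add: ennreal_of_nat_eq_real_of_nat)
      also have "\<dots> \<le> ennreal (real (2*q+1)) * ennreal (s k / (real k + 1))"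
        by (intro mult_left_mono hr) auto
      also have "\<dots> = ennreal (real (2*q+1) * (s k / (real k + 1)))"
        using spos by (subst ennreal_mult) auto
      also have "\<dots> \<le> ennreal \<epsilon>"
      proof (rule ennreal_leI)
        have "real (2*q+1) * s k \<le> (2 * (real M / s k) + 5) * s k"
          using q(2) spos by (intro mult_right_mono) auto
        also have "\<dots> = 2 * real M + 5 * s k"
          using spos by (simp add: field_simps)
        also have "\<dots> \<le> 2 * real M + 5" using s1 by simp
        finally have "real (2*q+1) * s k / (real k + 1) \<le> (2 * real M + 5) / (real k + 1)"
          by (intro divide_right_mono) auto
        then show "real (2*q+1) * (s k / (real k + 1)) \<le> \<epsilon>"
          using k(3) by simp
      qed
      finally show ?thesis .
    qed
    ultimately show "\<exists>U. delta_covering \<delta> (A \<inter> {- real M..real M}) U \<and>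
        (\<Sum>i. h (diameter (U i))) \<le> ennreal \<epsilon>" by blast
  qed
  then have "hausdorff_null h (\<Union>M. A \<inter> {- real M..real M})"
    by (rule hausdorff_null_UN)
  moreover have "A \<subseteq> (\<Union>M. A \<inter> {- real M..real M})"
  proof
    fix x assume "x \<in> A"
    moreover obtain M where "\<bar>x\<bar> \<le> real M" using real_arch_simple by blast
    ultimately show "x \<in> (\<Union>M. A \<inter> {- real M..real M})" by (auto simp: abs_le_iff intro!: exI[of _ M])
  qed
  ultimately show ?thesis
    unfolding A_def[symmetric] by (rule hausdorff_null_subset)
qed

section \<open>Condensation points and perfect sets\<close>

definition condensation_points :: "'a::topological_space set \<Rightarrow> 'a set" where
  "condensation_points E = {x. \<forall>U. open U \<and> x \<in> U \<longrightarrow> uncountable (U \<inter> E)}"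

text \<open>Each exceptional point has an open neighbourhood meeting \<open>E\<close> in a countable
  set. By Lindelof, countably many such neighbourhoods cover all exceptional points.\<close>

lemma countable_diff_condensation_points:
  fixes E :: "'a::second_countable_topology set"
  shows "countable (E - condensation_points E)"
proof -
  define F where "F = {U. open U \<and> countable (U \<inter> E)}"
  obtain F' where F': "F' \<subseteq> F" "countable F'" "\<Union>F' = \<Union>F"
    using Lindelof[of F] unfolding F_def by auto
  have "E - condensation_points E \<subseteq> (\<Union>U\<in>F'. U \<inter> E)"
  proof
    fix x assume "x \<in> E - condensation_points E"
    then have "x \<in> E" "x \<in> \<Union>F"
      unfolding F_def condensation_points_def by auto
    then show "x \<in> (\<Union>U\<in>F'. U \<inter> E)" using F'(3) by blast
  qed
  moreover have "countable (\<Union>U\<in>F'. U \<inter> E)"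
    using F' unfolding F_def by (intro countable_UN) auto
  ultimately show ?thesis by (rule countable_subset)
qed

lemma closed_condensation_points: "closed (condensation_points E)"
proof -
  have "- condensation_points E = \<Union>{U. open U \<and> countable (U \<inter> E)}"
    unfolding condensation_points_def by auto
  then show ?thesis
    unfolding closed_def by (auto intro: open_Union)
qed

lemma condensation_points_subset: "closed E \<Longrightarrow> condensation_points E \<subseteq> E"
  unfolding condensation_points_def closed_def
  by (auto dest!: spec[of _ "- E"])

text \<open>A neighbourhood isolating a condensation point x would contain, besides x, only points
  of \<open>E\<close> that are not condensation points. It would thus meet \<open>E\<close> in a
  countable set.\<close>

lemma perfect_condensation_points:
  fixes E :: "'a::second_countable_topology set"
  shows "perfect_set (condensation_points E)"
  unfolding perfect_set_def
proof (intro conjI notI closed_condensation_points)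
  assume "\<exists>x. x isolated_in condensation_points E"
  then obtain x U where x: "x \<in> condensation_points E" "open U" "U \<inter> condensation_points E = {x}"
    by (auto elim: isolated_inE)
  then have "uncountable (U \<inter> E)"
    unfolding condensation_points_def by blast
  moreover have "U \<inter> E \<subseteq> insert x (E - condensation_points E)"
    using x(3) by blast
  moreover have "countable (insert x (E - condensation_points E))"
    by (intro countable_insert countable_diff_condensation_points)
  ultimately show False
    using countable_subset by blast
qed

section \<open>Closedness of locally finite unions\<close>

lemma closed_UN_locally_finite:
  fixes F :: "'i \<Rightarrow> 'a::real_normed_vector set"
  assumes clo: "\<And>i. closed (F i)" and fin: "\<And>M. finite {i. F i \<inter> ball 0 M \<noteq> {}}"
  shows "closed (\<Union>i. F i)"
  unfolding closed_def
proof (subst open_subopen, intro ballI)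
  fix x assume x: "x \<in> - (\<Union>i. F i)"
  define I where "I = {i. F i \<inter> ball 0 (norm x + 1) \<noteq> {}}"
  define G where "G = ball 0 (norm x + 1) - (\<Union>i\<in>I. F i)"
  have "open G"
    unfolding G_def I_def using clo fin by (intro open_Diff closed_UN) auto
  moreover have "x \<in> G" using x unfolding G_def by auto
  moreover have "G \<subseteq> - (\<Union>i. F i)" unfolding G_def I_def by auto
  ultimately show "\<exists>T. open T \<and> x \<in> T \<and> T \<subseteq> - (\<Union>i. F i)" by blast
qed

lemma closed_lattice_neighbourhood:
  fixes s r :: real
  assumes "s > 0"
  shows "closed {x. \<exists>z::int. \<bar>x - s * z\<bar> \<le> r}"
proof -
  have "closed (\<Union>z::int. cball (s * z) r)"
  proof (rule closed_UN_locally_finite)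
    fix M
    have "{z::int. cball (s * z) r \<inter> ball 0 M \<noteq> {}} \<subseteq> {-\<lceil>(M + r) / s\<rceil>..\<lceil>(M + r) / s\<rceil>}"
    proof
      fix z :: int assume "z \<in> {z::int. cball (s * z) r \<inter> ball 0 M \<noteq> {}}"
      then obtain y where "\<bar>s * z - y\<bar> \<le> r" "\<bar>y\<bar> < M"
        by (auto simp: dist_real_def)
      then have "\<bar>s * z\<bar> \<le> M + r" by linarith
      then have "\<bar>real_of_int z\<bar> \<le> (M + r) / s"
        using assms by (simp add: abs_mult field_simps)
      then have "\<bar>z\<bar> \<le> \<lceil>(M + r) / s\<rceil>" by linarith
      then show "z \<in> {-\<lceil>(M + r) / s\<rceil>..\<lceil>(M + r) / s\<rceil>}" by auto
    qed
    then show "finite {z::int. cball (s * z) r \<inter> ball 0 M \<noteq> {}}"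
      using finite_subset by blast
  qed auto
  moreover have "{x. \<exists>z::int. \<bar>x - s * z\<bar> \<le> r} = (\<Union>z::int. cball (s * z) r)"
    by (auto simp: dist_real_def abs_minus_commute)
  ultimately show ?thesis by simp
qed

section \<open>Nested intervals and lattice approximation\<close>

text \<open>One refinement step. The lower bound \<open>c\<close> makes the image of a third of the
  interval at least 3s long, enough to contain some [sz, sz + r]; this is the origin of the 9. The
  upper bound \<open>B\<close> keeps the preimage from being too short for the next step.\<close>

lemma lattice_preimage_interval:
  fixes g :: "real \<Rightarrow> real"
  assumes cont: "continuous_on {a..b} g" and c: "c > 0" and ab: "a < b"
    and lip: "\<And>x y. \<lbrakk>a \<le> x; x < y; y \<le> b\<rbrakk> \<Longrightarrow> c * (y - x) \<le> \<bar>g y - g x\<bar> \<and> \<bar>g y - g x\<bar> \<le> B * (y - x)"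
    and r: "0 < r" "r \<le> s" and big: "9 * s \<le> c * (b - a)"
  obtains a' b' where "a \<le> a'" "a' < b'" "b' \<le> b" "r \<le> B * (b' - a')" "q \<notin> {a'..b'}"
    "\<And>t. t \<in> {a'..b'} \<Longrightarrow> \<exists>z::int. \<bar>g t - s * z\<bar> \<le> r"
proof -
  \<comment> \<open>One of the outer thirds of the interval misses \<open>q\<close>.\<close>
  obtain a1 b1 where 1: "a \<le> a1" "b1 \<le> b" "b1 - a1 = (b - a) / 3" "q \<notin> {a1..b1}"
  proof (cases "q > a + (b - a) / 3")
    case True
    then show ?thesis using that[of a "a + (b - a) / 3"] ab by (auto simp: field_simps)
  next
    case False
    then show ?thesis using that[of "b - (b - a) / 3" b] ab by (auto simp: field_simps)
  qed
  have "0 < (b - a) / 3" using ab by simp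
  then have ab1: "a1 < b1" unfolding 1(3)[symmetric] by simp
  have cont1: "continuous_on {a1..b1} g"
    using cont by (rule continuous_on_subset) (use 1 in auto)
  define lo where "lo = min (g a1) (g b1)"
  define hi where "hi = max (g a1) (g b1)"
  have "c * (b1 - a1) \<le> \<bar>g b1 - g a1\<bar>" using lip[of a1 b1] 1(1,2) ab1 by simp
  moreover have "3 * s \<le> c * (b1 - a1)" using big unfolding 1(3) by simp
  ultimately have hilo: "3 * s \<le> hi - lo" unfolding hi_def lo_def by (auto simp: min_def max_def)
  have ivt: "\<exists>x\<in>{a1..b1}. g x = y" if "lo \<le> y" "y \<le> hi" for y
  proof (cases "g a1 \<le> g b1")
    case True
    then show ?thesis using IVT'[of g a1 y b1] cont1 ab1 that unfolding lo_def hi_def by auto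
  next
    case False
    then show ?thesis using IVT2'[of g b1 y a1] cont1 ab1 that unfolding lo_def hi_def by auto
  qed
  have s: "s > 0" using r by linarith
  define z where "z = \<lceil>lo / s\<rceil>"
  have "lo / s \<le> z" "z \<le> lo / s + 1" unfolding z_def by linarith+
  then have z: "lo \<le> s * z" "s * z \<le> lo + s"
    using s by (auto simp: field_simps)
  obtain x1 where x1: "x1 \<in> {a1..b1}" "g x1 = s * z"
    using ivt[of "s * z"] z hilo s by auto
  obtain x2 where x2: "x2 \<in> {a1..b1}" "g x2 = s * z + r"
    using ivt[of "s * z + r"] z hilo s r by auto
  \<comment> \<open>The ends of the new interval are sent exactly to sz and sz + r, so its length is
    controlled through \<open>B\<close>.\<close>
  define a' where "a' = min x1 x2"
  define b' where "b' = max x1 x2"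
  have "x1 \<noteq> x2" using x1 x2 r by auto
  then have ab': "a1 \<le> a'" "a' < b'" "b' \<le> b1"
    using x1 x2 unfolding a'_def b'_def by auto
  have ends: "{g a', g b'} = {s * z, s * z + r}"
    using x1 x2 unfolding a'_def b'_def by (auto simp: min_def max_def)
  show thesis
  proof
    show "a \<le> a'" "a' < b'" "b' \<le> b" "q \<notin> {a'..b'}" using ab' 1 by auto
    have "\<bar>g b' - g a'\<bar> = r" using ends r by (auto simp: doubleton_eq_iff)
    then show "r \<le> B * (b' - a')" using lip[of a' b'] ab' 1 by auto
    \<comment> \<open>The lower bound makes \<open>g\<close> injective. A continuous injective
      function on an interval is monotone, so its values stay between those at the ends.\<close>
    have inj: "inj_on g {a'..b'}"
    proof (rule linorder_inj_onI)
      fix x y assume "x < y" "x \<in> {a'..b'}" "y \<in> {a'..b'}"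
      then have "0 < c * (y - x)" "c * (y - x) \<le> \<bar>g y - g x\<bar>"
        using lip[of x y] ab' 1 c by auto
      then show "g x \<noteq> g y" by auto
    qed auto
    have cont': "continuous_on {a'..b'} g"
      using cont1 by (rule continuous_on_subset) (use ab' in auto)
    fix t assume t: "t \<in> {a'..b'}"
    have "\<bar>g t - s * z\<bar> \<le> r"
    proof (cases "t = a' \<or> t = b'")
      case True
      then show ?thesis using ends r by (auto simp: doubleton_eq_iff)
    next
      case False
      then have "a' < t" "t < b'" using t by auto
      from continuous_inj_imp_mono[OF this cont' inj]
      show ?thesis using ends r by (auto simp: doubleton_eq_iff)
    qed
    then show "\<exists>z::int. \<bar>g t - s * z\<bar> \<le> r" by blast
  qed
qed

text \<open>Nested intervals whose invariant 9 \<open>s k\<close> \<le> c (b - a) is what the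
  refinement step consumes. The function may change from stage to stage, since only the common
  constants \<open>c\<close> and \<open>B\<close> matter. Stage \<open>k\<close> also removes the
  point \<open>q k\<close>.\<close>

lemma simultaneous_lattice_approximation:
  fixes g :: "nat \<Rightarrow> real \<Rightarrow> real" and q s r :: "nat \<Rightarrow> real"
  assumes cont: "\<And>k. continuous_on {u..u+1} (g k)" and c: "c > 0"
    and lip: "\<And>k x y. \<lbrakk>u \<le> x; x < y; y \<le> u + 1\<rbrakk>
        \<Longrightarrow> c * (y - x) \<le> \<bar>g k y - g k x\<bar> \<and> \<bar>g k y - g k x\<bar> \<le> B * (y - x)"
    and r: "\<And>k. 0 < r k" "\<And>k. r k \<le> s k"
    and s0: "9 * s 0 \<le> c" and sr: "\<And>k. 9 * s (Suc k) * B \<le> c * r k"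
  obtains t where "t \<in> {u..u+1}" "t \<notin> range q" "\<And>k. \<exists>z::int. \<bar>g k t - s k * z\<bar> \<le> r k"
proof -
  have Bpos: "B > 0"
    using lip[of u "u + 1" 0] c by auto
  define P where "P = (\<lambda>k (a, b). u \<le> a \<and> a < b \<and> b \<le> u + 1 \<and> 9 * s k \<le> c * (b - a))"
  define Q where "Q = (\<lambda>k (a, b) (a', b'). a \<le> a' \<and> b' \<le> b \<and> q k \<notin> {a'..b'} \<and>
      (\<forall>t\<in>{a'..b'}. \<exists>z::int. \<bar>g k t - s k * z\<bar> \<le> r k))"
  have "\<exists>I. \<forall>k. P k (I k) \<and> Q k (I k) (I (Suc k))"
  proof (rule dependent_nat_choice)
    show "\<exists>x. P 0 x" unfolding P_def using s0 by (intro exI[of _ "(u, u + 1)"]) auto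
  next
    fix x k assume "P k x"
    then obtain a b where x: "x = (a, b)" and ab: "u \<le> a" "a < b" "b \<le> u + 1" "9 * s k \<le> c * (b - a)"
      unfolding P_def by (cases x) auto
    have "continuous_on {a..b} (g k)"
      using cont by (rule continuous_on_subset) (use ab in auto)
    then obtain a' b' where *: "a \<le> a'" "a' < b'" "b' \<le> b" "r k \<le> B * (b' - a')" "q k \<notin> {a'..b'}"
      "\<And>t. t \<in> {a'..b'} \<Longrightarrow> \<exists>z::int. \<bar>g k t - s k * z\<bar> \<le> r k"
      by (rule lattice_preimage_interval[where c = c and r = "r k" and s = "s k" and B = B and q = "q k"])
         (use ab c lip r in auto)
    \<comment> \<open>The new interval has length at least \<open>r k / B\<close>, and
      \<open>sr\<close> turns this into the invariant for the next stage.\<close>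
    have "9 * s (Suc k) * B \<le> c * r k" by (rule sr)
    also have "\<dots> \<le> c * (B * (b' - a'))" using * c by simp
    finally have "B * (9 * s (Suc k)) \<le> B * (c * (b' - a'))" by (simp add: algebra_simps)
    then have "9 * s (Suc k) \<le> c * (b' - a')" using Bpos by simp
    then show "\<exists>y. P (Suc k) y \<and> Q k x y"
      unfolding P_def Q_def x using * ab by (intro exI[of _ "(a', b')"]) auto
  qed
  then obtain I where I: "\<And>k. P k (I k)" "\<And>k. Q k (I k) (I (Suc k))" by blast
  define J where "J = (\<lambda>k. {fst (I k)..snd (I k)})"
  have dec: "J (Suc k) \<subseteq> J k" for k
    using I(2)[of k] unfolding J_def Q_def by (auto split: prod.splits)
  have "\<Inter>(range J) \<noteq> {}"
  proof (rule compact_nest)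
    show "compact (J n)" "J n \<noteq> {}" for n
      using I(1)[of n] unfolding J_def P_def by (auto split: prod.splits)
    show "J n \<subseteq> J m" if "m \<le> n" for m n
      by (rule lift_Suc_antimono_le[of J, OF dec that])
  qed
  then obtain t where t: "\<And>k. t \<in> J k" by blast
  show thesis
  proof
    show "t \<in> {u..u+1}" using t[of 0] I(1)[of 0] unfolding J_def P_def by (auto split: prod.splits)
    have *: "t \<noteq> q k \<and> (\<exists>z::int. \<bar>g k t - s k * z\<bar> \<le> r k)" for k
      using t[of "Suc k"] I(2)[of k] unfolding J_def Q_def by (auto split: prod.splits)
    then show "t \<notin> range q" by auto
    show "\<exists>z::int. \<bar>g k t - s k * z\<bar> \<le> r k" for k using * by blast
  qed
qed

section \<open>Growth of real polynomials\<close>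

text \<open>To be applied to derivatives, as the source of the lower Lipschitz bound. The leading
  coefficient is a bound that also works for constant derivatives.\<close>

lemma poly_eventually_ge_lead_coeff:
  fixes p :: "real poly"
  assumes "p \<noteq> 0"
  shows "eventually (\<lambda>x. \<bar>lead_coeff p\<bar> \<le> \<bar>poly p x\<bar>) at_top"
proof -
  have *: "eventually (\<lambda>x. \<bar>lead_coeff q\<bar> \<le> \<bar>poly q x\<bar>) at_top" if "lead_coeff q > 0" for q :: "real poly"
  proof -
    obtain n where "\<forall>x\<ge>n. lead_coeff q \<le> poly q x"
      using poly_pinfty_gt_lc[OF \<open>lead_coeff q > 0\<close>] by blast
    then show ?thesis
      using that unfolding eventually_at_top_linorder by (intro exI[of _ n]) fastforce
  qed
  show ?thesis
  proof (cases "lead_coeff p > 0")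
    case True
    then show ?thesis by (rule *)
  next
    case False
    then have "lead_coeff (- p) > 0" using assms
      by (metis coeff_minus degree_minus leading_coeff_0_iff linorder_neqE_linordered_idom neg_0_less_iff_less)
    then show ?thesis using *[of "- p"] by simp
  qed
qed

lemma poly_over_exp_tendsto_0: "((\<lambda>x::real. poly p x / exp x) \<longlongrightarrow> 0) at_top"
proof -
  have "((\<lambda>x. \<Sum>i\<le>degree p. coeff p i * (x ^ i / exp x)) \<longlongrightarrow> (\<Sum>i\<le>degree p. coeff p i * 0)) at_top"
    by (intro tendsto_sum tendsto_mult tendsto_const tendsto_power_div_exp_0)
  then show ?thesis
    by (simp add: poly_altdef sum_divide_distrib)
qed

text \<open>The square has degree at least 2 and positive leading coefficient. The class numbers to
  be used grow linearly in the parameter, and a polynomial of degree 1 with small slope would not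
  outgrow them. This is why classes are bounded by the square of x and not by its absolute
  value.\<close>

lemma poly_square_eventually_ge_linear:
  fixes p :: "real poly"
  assumes "degree p > 0"
  shows "eventually (\<lambda>x. m * x + m \<le> (poly p x)\<^sup>2) at_top"
proof -
  define d where "d = [:- m, - m:] + p * p"
  have "degree (p * p) = degree p + degree p"
    using assms by (intro degree_mult_eq) auto
  then have "degree [:- m, - m:] < degree (p * p)"
    using assms by (auto intro: le_less_trans[OF degree_pCons_le])
  then have "lead_coeff d = lead_coeff (p * p)"
    unfolding d_def by (rule lead_coeff_add_le)
  also have "\<dots> > 0"
    using assms by (auto simp: lead_coeff_mult zero_less_mult_iff linorder_neq_iff[symmetric])
  finally have "lead_coeff d > 0" .
  then obtain n where "\<forall>x\<ge>n. lead_coeff d \<le> poly d x"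
    using poly_pinfty_gt_lc by blast
  then have "\<forall>x\<ge>n. 0 \<le> poly d x"
    using \<open>lead_coeff d > 0\<close> by fastforce
  then show ?thesis
    unfolding eventually_at_top_linorder d_def
    by (auto simp: power2_eq_square algebra_simps intro!: exI[of _ n])
qed

section \<open>Restriction of polynomials to a common line\<close>

lemma real_polynomial_function_line:
  fixes P :: "'a::real_normed_vector \<Rightarrow> real"
  assumes "real_polynomial_function P"
  obtains p where "\<And>t. P (a + t *\<^sub>R v) = poly p t"
proof -
  have "\<exists>p. \<forall>t. P (a + t *\<^sub>R v) = poly p t"
    using assms
  proof induction
    case (linear f)
    then interpret bounded_linear f .
    show ?case by (intro exI[of _ "[:f a, f v:]"]) (simp add: add scale)
  next
    case (const c)
    show ?case by (intro exI[of _ "[:c:]"]) simp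
  next
    case (add f g)
    then show ?case by (metis poly_add)
  next
    case (mult f g)
    then show ?case by (metis poly_mult)
  qed
  then show thesis using that by blast
qed

text \<open>Induction on the family: join a vector v good for the old members to a vector w good for
  the new one. Along this line no member is constantly equal to its value at 0, so each excludes
  only finitely many parameters.\<close>

lemma common_nonvanishing_direction:
  fixes \<F> :: "('a::real_normed_vector \<Rightarrow> real) set"
  assumes "finite \<F>" "\<And>P. P \<in> \<F> \<Longrightarrow> real_polynomial_function P \<and> \<not> P constant_on UNIV"
  obtains v where "\<And>P. P \<in> \<F> \<Longrightarrow> P v \<noteq> P 0"
proof -
  have "\<exists>v. \<forall>P\<in>\<F>. P v \<noteq> P 0"
    using assms
  proof (induction rule: finite_induct)
    case empty
    then show ?case by simp
  next
    case (insert R \<F>)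
    then obtain v where v: "\<forall>P\<in>\<F>. P v \<noteq> P 0" by auto
    obtain w where w: "R w \<noteq> R 0"
      using insert.prems[of R] unfolding constant_on_def by auto
    have "finite {t. P (v + t *\<^sub>R (w - v)) = P 0}" if P: "P \<in> insert R \<F>" for P
    proof -
      obtain p where p: "\<And>t. P (v + t *\<^sub>R (w - v)) = poly p t"
        using real_polynomial_function_line[of P v "w - v"] insert.prems[OF P] by blast
      have "poly p 0 \<noteq> P 0 \<or> poly p 1 \<noteq> P 0"
        using v w P unfolding p[symmetric] by auto
      then have "p - [:P 0:] \<noteq> 0" by auto
      then have "finite {t. poly (p - [:P 0:]) t = 0}" by (rule poly_roots_finite)
      then show ?thesis by (simp add: p)
    qed
    then have "finite (\<Union>P\<in>insert R \<F>. {t. P (v + t *\<^sub>R (w - v)) = P 0})"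
      using insert.hyps by blast
    then obtain t :: real where "t \<notin> (\<Union>P\<in>insert R \<F>. {t. P (v + t *\<^sub>R (w - v)) = P 0})"
      using ex_new_if_finite[OF infinite_UNIV_char_0] by blast
    then show ?case by (intro exI[of _ "v + t *\<^sub>R (w - v)"]) auto
  qed
  then show thesis using that by blast
qed

section \<open>Choice of the scales\<close>

lemma dimension_function_small:
  assumes "dimension_function h" "\<epsilon> > 0" "\<eta> > 0"
  obtains r where "0 < r" "r \<le> \<eta>" "h (2 * r) \<le> ennreal \<epsilon>"
proof -
  have "continuous (at_right 0) h" "h 0 = 0"
    using assms(1) by (auto simp: dimension_function_def)
  then have "(h \<longlongrightarrow> 0) (at_right 0)"
    by (simp add: continuous_within)
  then have "eventually (\<lambda>t. h t < ennreal \<epsilon>) (at_right 0)"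
    using assms(2) by (intro order_tendstoD(2)) auto
  then obtain b where b: "b > 0" "\<And>t. 0 < t \<Longrightarrow> t < b \<Longrightarrow> h t < ennreal \<epsilon>"
    unfolding eventually_at_right_field by blast
  define r where "r = min \<eta> (b / 3)"
  have "0 < 2 * r" "2 * r < b" "0 < r" "r \<le> \<eta>"
    using b(1) assms(3) unfolding r_def by auto
  then show thesis using that b(2)[of "2 * r"] by (auto simp: less_imp_le)
qed

text \<open>The scales are chosen alternately: \<open>s (Suc k)\<close> as
  \<open>r k * exp (- real (Suc k))\<close>, then \<open>r (Suc k)\<close> by right continuity of
  \<open>h\<close> at 0. The exponential factor must absorb the distortion of every finite family of
  polynomials, none of which is known at this point.\<close>

lemma scale_sequences:
  assumes "dimension_function h"
  obtains r s :: "nat \<Rightarrow> real" where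
    "\<And>k. 0 < r k" "\<And>k. r k \<le> s k" "\<And>k. s k \<le> exp (- real k)"
    "\<And>k. s (Suc k) \<le> r k * exp (- real (Suc k))"
    "\<And>k. h (2 * r k) \<le> ennreal (s k / (real k + 1))"
proof -
  define P where "P = (\<lambda>k (s, r). 0 < r \<and> r \<le> s \<and> s \<le> exp (- real k) \<and>
      h (2 * r) \<le> ennreal (s / (real k + 1)))"
  define Q where "Q = (\<lambda>k (s :: real, r) (s', r' :: real). s' \<le> r * exp (- real (Suc k)))"
  have ex: "\<exists>r. P k (s, r)" if s: "0 < s" "s \<le> exp (- real k)" for k s
  proof -
    obtain r where "0 < r" "r \<le> s" "h (2 * r) \<le> ennreal (s / (real k + 1))"
      using dimension_function_small[OF assms, of "s / (real k + 1)" s] s by auto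
    then show ?thesis using s unfolding P_def by auto
  qed
  have "\<exists>f. \<forall>k. P k (f k) \<and> Q k (f k) (f (Suc k))"
  proof (rule dependent_nat_choice)
    show "\<exists>x. P 0 x" using ex[of 1 0] by auto
  next
    fix x k assume "P k x"
    then obtain s r where x: "x = (s, r)" and sr: "0 < r" "r \<le> s" "s \<le> exp (- real k)"
      unfolding P_def by (cases x) auto
    have "s \<le> 1" using sr(3) by (rule order_trans) simp
    then have "r \<le> 1" using sr(2) by simp
    then have "r * exp (- real (Suc k)) \<le> 1 * exp (- real (Suc k))"
      by (intro mult_right_mono) auto
    then obtain r' where "P (Suc k) (r * exp (- real (Suc k)), r')"
      using ex[of "r * exp (- real (Suc k))" "Suc k"] sr(1) by auto
    then show "\<exists>y. P (Suc k) y \<and> Q k x y" unfolding x Q_def by auto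
  qed
  then obtain f where f: "\<And>k. P k (f k) \<and> Q k (f k) (f (Suc k))" by blast
  show thesis
  proof (rule that[of "\<lambda>k. snd (f k)" "\<lambda>k. fst (f k)"])
    fix k
    show "0 < snd (f k)" "snd (f k) \<le> fst (f k)" "fst (f k) \<le> exp (- real k)"
      "fst (f (Suc k)) \<le> snd (f k) * exp (- real (Suc k))"
      "h (2 * snd (f k)) \<le> ennreal (fst (f k) / (real k + 1))"
      using f[of k] unfolding P_def Q_def by (auto split: prod.splits)
  qed
qed

section \<open>Uniform Lipschitz bounds far out on the line\<close>

text \<open>Mean value theorem: the derivatives are eventually bounded below by a constant and above
  by any positive multiple of exp. The upper constant has the form
  \<open>c / 9 * exp (real T + 1)\<close> so that the 9 and the exponential cancel against the decay
  of the scales from stage \<open>T\<close> on.\<close>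

lemma polys_eventually_bilipschitz:
  fixes F :: "real poly set"
  assumes "finite F" "\<And>p. p \<in> F \<Longrightarrow> degree p > 0"
  obtains c T where "c > 0" "9 * exp (- real T) \<le> c"
    "\<And>p t. p \<in> F \<Longrightarrow> t \<ge> real T \<Longrightarrow> m * t + m \<le> (poly p t)\<^sup>2"
    "\<And>p x y. \<lbrakk>p \<in> F; real T \<le> x; x < y; y \<le> real T + 1\<rbrakk> \<Longrightarrow>
       c * (y - x) \<le> \<bar>poly p y - poly p x\<bar> \<and>
       \<bar>poly p y - poly p x\<bar> \<le> (c / 9 * exp (real T + 1)) * (y - x)"
proof -
  have nz: "pderiv p \<noteq> 0" if "p \<in> F" for p
    using assms(2)[OF that] by (simp add: pderiv_eq_0_iff)
  \<comment> \<open>Inserting 1 keeps \<open>Min\<close> meaningful for empty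
    \<open>F\<close>.\<close>
  define c where "c = Min (insert 1 ((\<lambda>p. \<bar>lead_coeff (pderiv p)\<bar>) ` F))"
  have c: "c > 0" "\<And>p. p \<in> F \<Longrightarrow> c \<le> \<bar>lead_coeff (pderiv p)\<bar>"
    using assms(1) nz unfolding c_def by auto
  have "eventually (\<lambda>t. m * t + m \<le> (poly p t)\<^sup>2 \<and> c \<le> \<bar>poly (pderiv p) t\<bar> \<and>
      \<bar>poly (pderiv p) t\<bar> \<le> c / 9 * exp t) at_top" if p: "p \<in> F" for p
  proof (intro eventually_conj)
    show "eventually (\<lambda>t. m * t + m \<le> (poly p t)\<^sup>2) at_top"
      using assms(2)[OF p] by (rule poly_square_eventually_ge_linear)
    show "eventually (\<lambda>t. c \<le> \<bar>poly (pderiv p) t\<bar>) at_top"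
      using poly_eventually_ge_lead_coeff[OF nz[OF p]]
      by (rule eventually_mono) (use c(2)[OF p] in auto)
    have "eventually (\<lambda>t. dist (poly (pderiv p) t / exp t) 0 < c / 9) at_top"
      using poly_over_exp_tendsto_0[of "pderiv p"] c(1) by (intro tendstoD) auto
    then show "eventually (\<lambda>t. \<bar>poly (pderiv p) t\<bar> \<le> c / 9 * exp t) at_top"
      by (rule eventually_mono) (auto simp: abs_divide field_simps)
  qed
  then have "eventually (\<lambda>t. \<forall>p\<in>F. m * t + m \<le> (poly p t)\<^sup>2 \<and> c \<le> \<bar>poly (pderiv p) t\<bar> \<and>
      \<bar>poly (pderiv p) t\<bar> \<le> c / 9 * exp t) at_top"
    using assms(1) by (simp add: eventually_ball_finite)
  then obtain X where X: "\<And>t p. \<lbrakk>t \<ge> X; p \<in> F\<rbrakk> \<Longrightarrow> m * t + m \<le> (poly p t)\<^sup>2 \<and>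
      c \<le> \<bar>poly (pderiv p) t\<bar> \<and> \<bar>poly (pderiv p) t\<bar> \<le> c / 9 * exp t"
    unfolding eventually_at_top_linorder by blast
  define T where "T = nat \<lceil>max X (9 / c)\<rceil>"
  have T: "X \<le> real T" "9 / c \<le> real T"
    unfolding T_def using real_nat_ceiling_ge[of "max X (9 / c)"] by auto
  show thesis
  proof (rule that[of c T])
    have "9 / c \<le> exp (real T)" using T(2) exp_ge_add_one_self[of "real T"] by linarith
    then show "9 * exp (- real T) \<le> c" using c(1) by (simp add: exp_minus field_simps)
    show "m * t + m \<le> (poly p t)\<^sup>2" if "p \<in> F" "t \<ge> real T" for p t
      using X[of t p] that T by auto
    fix p x y assume *: "p \<in> F" "real T \<le> x" "x < y" "y \<le> real T + 1"
    obtain t where t: "x < t" "t < y" "poly p y - poly p x = (y - x) * poly (pderiv p) t"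
      using poly_MVT[OF *(3), of p] by blast
    have d: "c \<le> \<bar>poly (pderiv p) t\<bar>" "\<bar>poly (pderiv p) t\<bar> \<le> c / 9 * exp t"
      using X[of t p] * t T by auto
    have "c / 9 * exp t \<le> c / 9 * exp (real T + 1)"
      using c(1) t * by (intro mult_left_mono) auto
    then have "\<bar>poly (pderiv p) t\<bar> \<le> c / 9 * exp (real T + 1)" using d(2) by simp
    then have "\<bar>poly (pderiv p) t\<bar> * (y - x) \<le> (c / 9 * exp (real T + 1)) * (y - x)"
      and "c * (y - x) \<le> \<bar>poly (pderiv p) t\<bar> * (y - x)"
      using *(3) d(1) by (auto intro!: mult_right_mono)
    moreover have "\<bar>poly p y - poly p x\<bar> = \<bar>poly (pderiv p) t\<bar> * (y - x)"
      using *(3) t(3) by (simp add: abs_mult)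
    ultimately show "c * (y - x) \<le> \<bar>poly p y - poly p x\<bar> \<and>
       \<bar>poly p y - poly p x\<bar> \<le> (c / 9 * exp (real T + 1)) * (y - x)" by simp
  qed (rule c(1))
qed

section \<open>The closed null set and the polynomials meeting it\<close>

text \<open>The class of stage \<open>k\<close> is \<open>fst (prod_decode k)\<close>. It is at most \<open>k\<close>, so class \<open>j\<close> imposes nothing
  before stage \<open>j\<close>.\<close>

definition lattice_class :: "(nat \<Rightarrow> real) \<Rightarrow> (nat \<Rightarrow> real) \<Rightarrow> nat \<Rightarrow> real set" where
  "lattice_class s r j =
     {x. real j \<le> x\<^sup>2 \<and> (\<forall>k. fst (prod_decode k) = j \<longrightarrow> (\<exists>z::int. \<bar>x - s k * z\<bar> \<le> r k))}"

lemma closed_UN_lattice_class: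
  assumes "\<And>k. s k > 0"
  shows "closed (\<Union>j. lattice_class s r j)"
proof (rule closed_UN_locally_finite)
  fix j
  have "lattice_class s r j = {x. real j \<le> x\<^sup>2} \<inter>
      (\<Inter>k\<in>{k. fst (prod_decode k) = j}. {x. \<exists>z::int. \<bar>x - s k * z\<bar> \<le> r k})"
    unfolding lattice_class_def by auto
  also have "closed \<dots>"
    by (intro closed_Int closed_INT ballI closed_lattice_neighbourhood assms closed_Collect_le
        continuous_intros)
  finally show "closed (lattice_class s r j)" .
next
  fix M
  have "{j. lattice_class s r j \<inter> ball 0 M \<noteq> {}} \<subseteq> {..nat \<lceil>M\<^sup>2\<rceil>}"
  proof
    fix j assume "j \<in> {j. lattice_class s r j \<inter> ball 0 M \<noteq> {}}"
    then obtain x where x: "real j \<le> x\<^sup>2" "\<bar>x\<bar> < M" unfolding lattice_class_def by auto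
    then have "x\<^sup>2 \<le> M\<^sup>2" by (intro abs_le_square_iff[THEN iffD1]) auto
    then show "j \<in> {..nat \<lceil>M\<^sup>2\<rceil>}" using x(1) by auto linarith
  qed
  then show "finite {j. lattice_class s r j \<inter> ball 0 M \<noteq> {}}"
    by (rule finite_subset) simp
qed

lemma hausdorff_null_UN_lattice_class:
  assumes "h 0 = 0"
    and "\<And>k. 0 < r k" "\<And>k. r k \<le> s k" "\<And>k. s k \<le> exp (- real k)"
    and "\<And>k. h (2 * r k) \<le> ennreal (s k / (real k + 1))"
  shows "hausdorff_null h (\<Union>j. lattice_class s r j)"
proof (rule hausdorff_null_UN)
  fix j
  \<comment> \<open>Every class contains infinitely many stages.\<close>
  have "\<exists>k\<ge>m. fst (prod_decode k) = j" for m
    by (intro exI[of _ "prod_encode (j, m)"]) (simp add: le_prod_encode_2)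
  with assms have "hausdorff_null h
      {x. \<forall>k. fst (prod_decode k) = j \<longrightarrow> (\<exists>z::int. \<bar>x - s k * z\<bar> \<le> r k)}"
    by (intro hausdorff_null_lattice_neighbourhoods) auto
  then show "hausdorff_null h (lattice_class s r j)"
    by (rule hausdorff_null_subset) (auto simp: lattice_class_def)
qed

text \<open>The nested intervals start from [T, T + 1] at stage \<open>T\<close>, where
  \<open>s T\<close> is already small compared to \<open>c\<close>. Skipping the earlier stages is
  harmless because the chosen classes have numbers at least \<open>T\<close>.\<close>

lemma polys_meet_lattice_classes:
  fixes F :: "real poly set"
  assumes F: "finite F" "\<And>p. p \<in> F \<Longrightarrow> degree p > 0"
    and r: "\<And>k. 0 < r k" "\<And>k. r k \<le> s k" and s: "\<And>k. s k \<le> exp (- real k)"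
    and sr: "\<And>k. s (Suc k) \<le> r k * exp (- real (Suc k))"
    and "countable C"
  obtains t where "t \<notin> C" "\<And>p. p \<in> F \<Longrightarrow> poly p t \<in> (\<Union>j. lattice_class s r j)"
proof (cases "F = {}")
  case True
  obtain t :: real where "t \<notin> C"
    using \<open>countable C\<close> uncountable_UNIV_real by (metis UNIV_eq_I)
  then show thesis using that True by blast
next
  case False
  define n where "n = card F"
  have n: "n > 0" using False F(1) unfolding n_def by auto
  obtain e where e: "bij_betw e {..<n} F"
    using ex_bij_betw_nat_finite[OF F(1)] unfolding n_def atLeast0LessThan by blast
  obtain c T where cT: "c > 0" "9 * exp (- real T) \<le> c"
    and ge: "\<And>p t. p \<in> F \<Longrightarrow> t \<ge> real T \<Longrightarrow> real n * t + real n \<le> (poly p t)\<^sup>2"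
    and lip: "\<And>p x y. \<lbrakk>p \<in> F; real T \<le> x; x < y; y \<le> real T + 1\<rbrakk> \<Longrightarrow>
       c * (y - x) \<le> \<bar>poly p y - poly p x\<bar> \<and>
       \<bar>poly p y - poly p x\<bar> \<le> (c / 9 * exp (real T + 1)) * (y - x)"
    using polys_eventually_bilipschitz[OF F, where m = "real n"] by blast
  \<comment> \<open>Classes are reduced modulo \<open>n\<close>: the \<open>i\<close>-th polynomial lands in class \<open>n * T + i\<close>, and the other
    classes congruent to \<open>i\<close> constrain it needlessly, which saves a case distinction.\<close>
  define g where "g = (\<lambda>k. e (fst (prod_decode (T + k)) mod n))"
  have g: "g k \<in> F" for k
    using e n unfolding g_def bij_betw_def by auto
  obtain q :: "nat \<Rightarrow> real" where q: "C \<subseteq> range q"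
    using \<open>countable C\<close> by (metis from_nat_into_surj rangeI subsetI)
  obtain t where t: "t \<in> {real T..real T+1}" "t \<notin> range q"
      "\<And>k. \<exists>z::int. \<bar>poly (g k) t - s (T + k) * z\<bar> \<le> r (T + k)"
  proof (rule simultaneous_lattice_approximation[where u = "real T" and g = "\<lambda>k. poly (g k)"
        and s = "\<lambda>k. s (T + k)" and r = "\<lambda>k. r (T + k)" and q = q and c = c
        and B = "c / 9 * exp (real T + 1)"])
    show "9 * s (T + 0) \<le> c" using s[of T] cT(2) by simp
    fix k
    have "9 * s (T + Suc k) * (c / 9 * exp (real T + 1)) = c * (s (Suc (T + k)) * exp (real T + 1))"
      by simp
    also have "s (Suc (T + k)) * exp (real T + 1)
        \<le> (r (T + k) * exp (- real (Suc (T + k)))) * exp (real T + 1)"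
      by (intro mult_right_mono sr) auto
    also have "\<dots> = r (T + k) * exp (- real k)"
      by (simp add: exp_add[symmetric])
    also have "\<dots> \<le> r (T + k) * 1"
      using r(1)[of "T + k"] by (intro mult_left_mono) auto
    finally show "9 * s (T + Suc k) * (c / 9 * exp (real T + 1)) \<le> c * r (T + k)"
      using cT(1) by simp
  qed (use cT lip[OF g] r in \<open>auto intro!: continuous_intros\<close>)
  show thesis
  proof
    show "t \<notin> C" using t(2) q by blast
    fix p assume p: "p \<in> F"
    then obtain i where i: "i < n" "p = e i" using e unfolding bij_betw_def by auto
    define j where "j = n * T + i"
    have "real j \<le> real n * real T + real n" unfolding j_def using i by simp
    also have "\<dots> \<le> real n * t + real n" using t(1) by (simp add: mult_left_mono)
    also have "\<dots> \<le> (poly p t)\<^sup>2" using ge[OF p] t(1) by simp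
    finally have "real j \<le> (poly p t)\<^sup>2" .
    moreover have "\<exists>z::int. \<bar>poly p t - s k * z\<bar> \<le> r k" if k: "fst (prod_decode k) = j" for k
    proof -
      \<comment> \<open>Every stage \<open>k\<close> of class \<open>j\<close> satisfies T \<le> nT
        \<le> j \<le> k, so it is among the stages treated, as number k - T. There \<open>g\<close>
        selects the polynomial \<open>e i\<close>, because \<open>j mod n = i\<close>.\<close>
      have "j \<le> k"
        using le_prod_encode_1[of j "snd (prod_decode k)"] k by (metis prod.collapse prod_decode_inverse)
      moreover have "T \<le> n * T" using n by simp
      ultimately have "T \<le> k" unfolding j_def by linarith
      moreover have "j mod n = i" unfolding j_def using i by simp
      ultimately show ?thesis using t(3)[of "k - T"] k i unfolding g_def by simp
    qed
    ultimately show "poly p t \<in> (\<Union>j. lattice_class s r j)"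
      unfolding lattice_class_def by blast
  qed
qed

theorem theorem3p9:
  fixes h :: "real \<Rightarrow> ennreal"
  assumes "dimension_function h"
  shows "\<exists>E :: real set. perfect_set E \<and> hausdorff_measure h E = 0 \<and>
           (\<forall>\<F> :: (real ^ 'n \<Rightarrow> real) set.
              finite \<F> \<and> \<F> \<subseteq> nonconstant_polynomials \<longrightarrow> (\<Inter>P\<in>\<F>. P -` E) \<noteq> {})"
proof -
  obtain r s where r: "\<And>k. 0 < r k" "\<And>k. r k \<le> s k" and s: "\<And>k. s k \<le> exp (- real k)"
    and sr: "\<And>k. s (Suc k) \<le> r k * exp (- real (Suc k))"
    and hr: "\<And>k. h (2 * r k) \<le> ennreal (s k / (real k + 1))"
    by (rule scale_sequences[OF assms]) (rule that)
  define A where "A = (\<Union>j. lattice_class s r j)"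
  define E where "E = condensation_points A"
  have "closed A"
    unfolding A_def using r by (intro closed_UN_lattice_class) (meson less_le_trans)
  then have "E \<subseteq> A" unfolding E_def by (rule condensation_points_subset)
  have "hausdorff_null h A"
    unfolding A_def using assms r s hr
    by (intro hausdorff_null_UN_lattice_class) (auto simp: dimension_function_def)
  then have "hausdorff_measure h E = 0"
    using \<open>E \<subseteq> A\<close> by (intro hausdorff_null_imp_measure_0) (rule hausdorff_null_subset)
  moreover have "perfect_set E"
    unfolding E_def by (rule perfect_condensation_points)
  moreover have "(\<Inter>P\<in>\<F>. P -` E) \<noteq> {}"
    if \<F>: "finite \<F>" "\<F> \<subseteq> nonconstant_polynomials" for \<F> :: "(real ^ 'n \<Rightarrow> real) set"
  proof -
    have pol: "real_polynomial_function P \<and> \<not> P constant_on UNIV" if "P \<in> \<F>" for P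
      using \<F>(2) that unfolding nonconstant_polynomials_def by blast
    obtain v where v: "\<And>P. P \<in> \<F> \<Longrightarrow> P v \<noteq> P 0"
      using common_nonvanishing_direction[OF \<F>(1) pol] by blast
    have "\<exists>p. \<forall>t. P (t *\<^sub>R v) = poly p t" if "P \<in> \<F>" for P
      using real_polynomial_function_line[of P 0 v] pol[OF that] by (metis add_0)
    then obtain p where p: "\<And>P t. P \<in> \<F> \<Longrightarrow> P (t *\<^sub>R v) = poly (p P) t" by metis
    have deg: "degree (p P) > 0" if P: "P \<in> \<F>" for P
    proof (rule ccontr)
      assume "\<not> degree (p P) > 0"
      then obtain a where "p P = [:a:]" by (auto elim: degree_eq_zeroE)
      then have "poly (p P) 1 = poly (p P) 0" by simp
      then show False using p[OF P, of 1] p[OF P, of 0] v[OF P] by simp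
    qed
    \<comment> \<open>The parameters at which some polynomial takes a value in \<open>A\<close> that
      is not a condensation point. They are countably many, since nonconstant polynomials have
      finite fibres, and avoiding them moves the values from \<open>A\<close> into
      \<open>E\<close>.\<close>
    define C where "C = (\<Union>P\<in>\<F>. \<Union>y\<in>A - E. {t. poly (p P) t = y})"
    have "finite {t. poly (p P) t = y}" if "P \<in> \<F>" for P y
    proof -
      have "p P - [:y:] \<noteq> 0" using deg[OF that] by auto
      then have "finite {t. poly (p P - [:y:]) t = 0}" by (rule poly_roots_finite)
      then show ?thesis by simp
    qed
    then have "countable C"
      unfolding C_def E_def using \<F>(1)
      by (intro countable_UN countable_diff_condensation_points)
         (auto intro: countable_finite)
    then obtain t where t: "t \<notin> C" "\<And>q. q \<in> p ` \<F> \<Longrightarrow> poly q t \<in> A"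
      using polys_meet_lattice_classes[of "p ` \<F>" r s C] \<F>(1) deg r s sr unfolding A_def by blast
    have "P (t *\<^sub>R v) \<in> E" if "P \<in> \<F>" for P
      using t that unfolding p[OF that] C_def by blast
    then show ?thesis by blast
  qed
  ultimately show ?thesis by blast
qed

end
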